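(* Let $b\in(-1,1)$ and let $d\geqslant 0$ satisfy $d\leqslant\frac{4}{\pi}\cos\left(\frac{\pi}{2}b\right)$. Put $a=\tan\frac{b\pi}{4}$ and $c=\frac{\pi}{4}\,\frac{1}{\cos\left(\frac{\pi}{2}b\right)}\,d$. Let $u:\mathbb{U}\rightarrow(-1,1)$ be a harmonic function such that (R1) $u(0)=b$, and (R2) $|\nabla u(0)|=d$. Then, for all $z\in\mathbb{U}$, $$\frac{4}{\pi}\arctan\varphi_{a}\big(-|z|\varphi_{c}(|z|)\big)\leqslant u(z)\leqslant\frac{4}{\pi}\arctan\varphi_{a}\big(|z|\varphi_{c}(|z|)\big).$$ These inequalities are sharp at each point $z\in\mathbb{U}$ in the following sense: for arbitrary $z\in\mathbb{U}$ there exist harmonic functions $\widehat{u}^z,\widetilde{u}^z:\mathbb{U}\rightarrow(-1,1)$, depending on $z$, each of which satisfies (R1) and (R2) (with the same $b$ and $d$), such that $$\widehat{u}^z(z)=\frac{4}{\pi}\arctan\varphi_{a}\big(-|z|\varphi_{c}(|z|)\big)\quad\text{and}\quad \widetilde{u}^z(z)=\frac{4}{\pi}\arctan\varphi_{a}\big(|z|\varphi_{c}(|z|)\big).$$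
   Context: $\mathbb{U}=\{z\in\mathbb{C}:|z|<1\}$ is the open unit disk. For $\alpha\in\mathbb{U}$, $\varphi_{\alpha}(z)=\frac{\alpha+z}{1+\overline{\alpha}z}$ for $z\in\mathbb{U}$; in particular for real $\alpha\in(-1,1)$ and real $t\in(-1,1)$, $\varphi_\alpha(t)=\frac{\alpha+t}{1+\alpha t}$. Convention: if $c=1$, then $\varphi_c(|z|)$ is understood to be $1$ for all $z\in\mathbb{U}$. For a real-valued $C^1$ function $u$ on $\mathbb{U}$, $\nabla u=(u_x,u_y)$ is its gradient and $|\nabla u|=\sqrt{u_x^2+u_y^2}$. *)

theory Defs
  imports "HOL-Analysis.Analysis"
begin

abbreviation unit_disk :: "complex set" where
  "unit_disk \<equiv> ball 0 1"

text \<open>The plane is identified with \<^typ>\<open>complex\<close>, so the coordinate directions are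
  \<open>1\<close> and \<open>\<i>\<close>. The values are meaningful only where the function is differentiable.\<close>

definition partial_x :: "(complex \<Rightarrow> real) \<Rightarrow> complex \<Rightarrow> real" where
  "partial_x u z = frechet_derivative u (at z) 1"

definition partial_y :: "(complex \<Rightarrow> real) \<Rightarrow> complex \<Rightarrow> real" where
  "partial_y u z = frechet_derivative u (at z) \<i>"

definition gradient :: "(complex \<Rightarrow> real) \<Rightarrow> complex \<Rightarrow> real \<times> real" where
  "gradient u z = (partial_x u z, partial_y u z)"

lemma norm_gradient: "norm (gradient u z) = sqrt ((partial_x u z)\<^sup>2 + (partial_y u z)\<^sup>2)"
  by (simp add: gradient_def norm_Pair)

text \<open>In the next three definitions \<open>S\<close> is meant to be open; values outside \<open>S\<close> are then irrelevant.\<close>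

definition C1_on :: "complex set \<Rightarrow> (complex \<Rightarrow> real) \<Rightarrow> bool" where
  "C1_on S u \<longleftrightarrow> (\<forall>z\<in>S. u differentiable (at z)) \<and>
     continuous_on S (partial_x u) \<and> continuous_on S (partial_y u)"

definition C2_on :: "complex set \<Rightarrow> (complex \<Rightarrow> real) \<Rightarrow> bool" where
  "C2_on S u \<longleftrightarrow> C1_on S u \<and> C1_on S (partial_x u) \<and> C1_on S (partial_y u)"

definition harmonic_on :: "complex set \<Rightarrow> (complex \<Rightarrow> real) \<Rightarrow> bool" where
  "harmonic_on S u \<longleftrightarrow> C2_on S u \<and>
     (\<forall>z\<in>S. partial_x (partial_x u) z + partial_y (partial_y u) z = 0)"

definition phi :: "complex \<Rightarrow> complex \<Rightarrow> complex" where
  "phi \<alpha> z = (\<alpha> + z) / (1 + cnj \<alpha> * z)"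

definition phi_real :: "real \<Rightarrow> real \<Rightarrow> real" where
  "phi_real \<alpha> t = (\<alpha> + t) / (1 + \<alpha> * t)"

lemma phi_of_real: "phi (of_real \<alpha>) (of_real t) = of_real (phi_real \<alpha> t)"
  by (simp add: phi_def phi_real_def)

text \<open>The convention that \<open>\<phi>\<^sub>c(|z|)\<close> is \<open>1\<close> when \<open>c = 1\<close> needs no separate case.\<close>

lemma phi_real_one: "phi_real 1 (cmod z) = 1"
proof -
  have "1 + cmod z \<noteq> 0"
    using norm_ge_zero[of z] by linarith
  then show ?thesis
    by (simp add: phi_real_def)
qed

end

theory Submission
  imports Defs "HOL-Complex_Analysis.Complex_Analysis"
begin

text \<open>
  Write \<open>u = Re F\<close> with \<open>F\<close> holomorphic, and put \<open>W = \<pi>F/4\<close>, \<open>A = \<pi>b/4\<close>. The map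
  \<open>W \<mapsto> sin (W - A) / cos (W + A)\<close>, which is \<open>\<phi>\<^sub>-\<^sub>a \<circ> tan\<close>, sends the strip \<open>|Re W| < \<pi>/4\<close> into the
  disk, so its composite \<open>h\<close> with \<open>W\<close> is a self-map of the disk with \<open>h 0 = 0\<close> and \<open>|h' 0| = c\<close>;
  Schwarz--Pick applied to \<open>h z / z\<close> gives \<open>|h z| \<le> |z| \<phi>\<^sub>c(|z|)\<close>. For \<open>W = X + iY\<close>,
  \<open>|h|\<^sup>2 = (sin\<^sup>2(X - A) + sinh\<^sup>2 Y) / (cos\<^sup>2(X + A) + sinh\<^sup>2 Y)\<close> is smallest at \<open>Y = 0\<close>, so the same
  bound holds for \<open>\<phi>\<^sub>-\<^sub>a(tan X)\<close>, which determines \<open>u = 4X/\<pi>\<close>. Equality is attained by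
  \<open>Re (4/\<pi> arctan \<phi>\<^sub>a(h))\<close> with \<open>h w = \<plusminus> e w \<phi>\<^sub>c(e w)\<close>, where \<open>|e| = 1\<close> and \<open>e z = |z|\<close>.
\<close>

section \<open>Partial derivatives, and real parts of holomorphic functions\<close>

lemma partial_has_derivative:
  assumes "(u has_derivative u') (at z)"
  shows "partial_x u z = u' 1" "partial_y u z = u' \<i>"
  using assms by (simp_all add: partial_x_def partial_y_def flip: frechet_derivative_at)

lemma has_derivative_partials:
  assumes "u differentiable (at z)"
  shows "(u has_derivative (\<lambda>w. Re w * partial_x u z + Im w * partial_y u z)) (at z)"
proof -
  let ?D = "frechet_derivative u (at z)"
  have D: "(u has_derivative ?D) (at z)"
    using assms frechet_derivative_works by blast
  then have lin: "linear ?D"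
    by (rule has_derivative_linear)
  have "?D w = Re w * partial_x u z + Im w * partial_y u z" for w
  proof -
    have "w = Re w *\<^sub>R 1 + Im w *\<^sub>R \<i>"
      by (simp add: complex_eq_iff)
    then have "?D w = ?D (Re w *\<^sub>R 1 + Im w *\<^sub>R \<i>)"
      by simp
    then show ?thesis
      by (simp add: linear_add[OF lin] linear_scale[OF lin] partial_x_def partial_y_def)
  qed
  then have "?D = (\<lambda>w. Re w * partial_x u z + Im w * partial_y u z)"
    by blast
  with D show ?thesis
    by simp
qed

lemma Re_has_derivative:
  assumes "(F has_field_derivative F') (at z)"
  shows "((\<lambda>w. Re (F w)) has_derivative (\<lambda>h. Re (F' * h))) (at z)"
  using assms unfolding has_field_derivative_def by (rule has_derivative_Re)

lemma partial_Re:
  assumes "(F has_field_derivative F') (at z)"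
  shows "partial_x (\<lambda>w. Re (F w)) z = Re F'" "partial_y (\<lambda>w. Re (F w)) z = - Im F'"
  using partial_has_derivative[OF Re_has_derivative[OF assms]] by simp_all

lemma norm_gradient_Re:
  assumes "(F has_field_derivative F') (at z)"
  shows "norm (gradient (\<lambda>w. Re (F w)) z) = cmod F'"
  by (simp add: norm_gradient partial_Re[OF assms] cmod_def)

text \<open>Derivatives at a point of an open set depend only on values nearby. This is needed
  because identities such as \<open>partial_x u = Re F'\<close> hold only on \<open>S\<close>, not
  as equalities of total functions.\<close>

lemma C1_on_cong:
  assumes "open S" "C1_on S v" and eq: "\<And>z. z \<in> S \<Longrightarrow> u z = v z"
  shows "C1_on S u"
    and "z \<in> S \<Longrightarrow> partial_x u z = partial_x v z"
    and "z \<in> S \<Longrightarrow> partial_y u z = partial_y v z"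
proof -
  have D: "(u has_derivative frechet_derivative v (at z)) (at z)" if "z \<in> S" for z
  proof (rule has_derivative_transform_within_open[OF _ \<open>open S\<close> that])
    show "(v has_derivative frechet_derivative v (at z)) (at z)"
      using assms(2) that frechet_derivative_works unfolding C1_on_def by blast
  qed (simp add: eq)
  show x: "partial_x u z = partial_x v z" if "z \<in> S" for z
    using partial_has_derivative(1)[OF D[OF that]] by (simp add: partial_x_def)
  show y: "partial_y u z = partial_y v z" if "z \<in> S" for z
    using partial_has_derivative(2)[OF D[OF that]] by (simp add: partial_y_def)
  show "C1_on S u"
    using assms(2) D x y unfolding C1_on_def differentiable_def
    by (auto cong: continuous_on_cong)
qed

lemma C1_on_Re:
  assumes "open S" "F holomorphic_on S"
  shows "C1_on S (\<lambda>w. Re (F w))"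
proof -
  have D: "(F has_field_derivative deriv F z) (at z)" if "z \<in> S" for z
    using assms holomorphic_derivI that by blast
  have "continuous_on S (deriv F)"
    using assms by (intro holomorphic_on_imp_continuous_on holomorphic_deriv)
  then show ?thesis
    using Re_has_derivative[OF D] unfolding C1_on_def differentiable_def
    by (auto simp: partial_Re[OF D] cong: continuous_on_cong intro!: continuous_intros)
qed

text \<open>The first partials of \<open>Re F\<close> are \<open>Re F'\<close> and
  \<open>Re (\<i> F')\<close>, again real parts of holomorphic functions, so the first-order results
  apply a second time. The pure second partials are \<open>Re F''\<close> and
  \<open>- Re F''\<close>.\<close>

lemma harmonic_on_Re:
  assumes "open S" "F holomorphic_on S"
  shows "harmonic_on S (\<lambda>w. Re (F w))"
proof -
  let ?u = "\<lambda>w. Re (F w)"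
  let ?G = "\<lambda>w. \<i> * deriv F w"
  have D: "(F has_field_derivative deriv F z) (at z)" if "z \<in> S" for z
    using assms holomorphic_derivI that by blast
  have hol: "deriv F holomorphic_on S" "?G holomorphic_on S"
    using assms by (auto intro!: holomorphic_intros)
  have D2: "(deriv F has_field_derivative deriv (deriv F) z) (at z)" if "z \<in> S" for z
    using assms(1) hol(1) holomorphic_derivI that by blast
  have D3: "(?G has_field_derivative \<i> * deriv (deriv F) z) (at z)" if "z \<in> S" for z
    using D2[OF that] by (auto intro!: derivative_eq_intros)
  have x: "partial_x ?u z = Re (deriv F z)" and y: "partial_y ?u z = Re (?G z)" if "z \<in> S" for z
    using partial_Re[OF D[OF that]] by simp_all
  note cx = C1_on_cong[OF assms(1) C1_on_Re[OF assms(1) hol(1)], of "partial_x ?u"]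
  note cy = C1_on_cong[OF assms(1) C1_on_Re[OF assms(1) hol(2)], of "partial_y ?u"]
  have "partial_x (partial_x ?u) z + partial_y (partial_y ?u) z = 0" if "z \<in> S" for z
  proof -
    have "partial_x (partial_x ?u) z = Re (deriv (deriv F) z)"
      using cx(2)[OF x that] partial_Re(1)[OF D2[OF that]] by simp
    moreover have "partial_y (partial_y ?u) z = - Im (\<i> * deriv (deriv F) z)"
      using cy(3)[OF y that] partial_Re(2)[OF D3[OF that]] by metis
    ultimately show ?thesis
      by simp
  qed
  then show ?thesis
    using C1_on_Re[OF assms] cx(1)[OF x] cy(1)[OF y] unfolding harmonic_on_def C2_on_def by blast
qed

section \<open>Symmetry of mixed partials, and harmonic functions as real parts\<close>

text \<open>The mean value theorem is used twice: first for the map sending \<open>s\<close> to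
  \<open>f s h - f s 0\<close>, then for \<open>fx s\<close>. The double difference is symmetric in
  the two variables, so the same number can be evaluated with the order of differentiation
  reversed.\<close>

lemma double_difference_mvt:
  fixes f fx fxy :: "real \<Rightarrow> real \<Rightarrow> real"
  assumes h: "0 < h"
    and fx: "\<And>s t. 0 \<le> s \<Longrightarrow> s \<le> h \<Longrightarrow> 0 \<le> t \<Longrightarrow> t \<le> h \<Longrightarrow>
      ((\<lambda>s. f s t) has_real_derivative fx s t) (at s)"
    and fxy: "\<And>s t. 0 \<le> s \<Longrightarrow> s \<le> h \<Longrightarrow> 0 \<le> t \<Longrightarrow> t \<le> h \<Longrightarrow>
      (fx s has_real_derivative fxy s t) (at t)"
  obtains s t where "0 < s" "s < h" "0 < t" "t < h"
    "f h h - f h 0 - f 0 h + f 0 0 = h\<^sup>2 * fxy s t"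
proof -
  have "\<exists>s>0. s < h \<and> (f h h - f h 0) - (f 0 h - f 0 0) = (h - 0) * (fx s h - fx s 0)"
    using h by (intro MVT2 DERIV_diff fx) auto
  then obtain s where s: "0 < s" "s < h" "(f h h - f h 0) - (f 0 h - f 0 0) = h * (fx s h - fx s 0)"
    by auto
  have "\<exists>t>0. t < h \<and> fx s h - fx s 0 = (h - 0) * fxy s t"
    using h s by (intro MVT2 fxy) auto
  then obtain t where "0 < t" "t < h" "fx s h - fx s 0 = h * fxy s t"
    by auto
  with s that show thesis
    by (simp add: power2_eq_square algebra_simps)
qed

lemma DERIV_partial_x:
  assumes "u differentiable (at (Complex s t))"
  shows "((\<lambda>s. u (Complex s t)) has_real_derivative partial_x u (Complex s t)) (at s)"
proof -
  have "((\<lambda>s. Complex s t) has_derivative of_real) (at s)"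
    unfolding Complex_eq by (auto intro!: derivative_eq_intros)
  from has_derivative_compose[OF this has_derivative_partials[OF assms]]
  show ?thesis
    by (simp add: has_field_derivative_def mult.commute[of _ "partial_x u _"])
qed

lemma DERIV_partial_y:
  assumes "u differentiable (at (Complex s t))"
  shows "((\<lambda>t. u (Complex s t)) has_real_derivative partial_y u (Complex s t)) (at t)"
proof -
  have "((\<lambda>t. Complex s t) has_derivative (\<lambda>h. \<i> * of_real h)) (at t)"
    unfolding Complex_eq by (auto intro!: derivative_eq_intros)
  from has_derivative_compose[OF this has_derivative_partials[OF assms]]
  show ?thesis
    by (simp add: has_field_derivative_def mult.commute[of _ "partial_y u _"])
qed

text \<open>On every small square with corner \<open>z\<close>, each mixed partial takes at some
  point the value of the double difference divided by \<open>h^2\<close>. Continuity at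
  \<open>z\<close> carries this common value over to \<open>z\<close> up to an arbitrary
  \<open>e\<close>.\<close>

lemma mixed_partials_eq:
  assumes S: "open S" "z \<in> S" and u: "C2_on S u"
  shows "partial_y (partial_x u) z = partial_x (partial_y u) z"
proof -
  have diff: "u differentiable (at w)" "partial_x u differentiable (at w)"
    "partial_y u differentiable (at w)" if "w \<in> S" for w
    using u that unfolding C2_on_def C1_on_def by auto
  let ?p = "partial_y (partial_x u)" and ?q = "partial_x (partial_y u)"
  have "continuous_on S (\<lambda>w. ?p w)" "continuous_on S (\<lambda>w. ?q w)"
    using u unfolding C2_on_def C1_on_def by auto
  then have cont: "isCont ?p z" "isCont ?q z"
    using S continuous_on_eq_continuous_at by auto
  have "\<bar>?p z - ?q z\<bar> < e" if "e > 0" for e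
  proof -
    obtain r0 where r0: "r0 > 0" "ball z r0 \<subseteq> S"
      using S openE by blast
    obtain r1 where r1: "r1 > 0" "\<And>w. dist w z < r1 \<Longrightarrow> dist (?p w) (?p z) < e / 2"
      using cont(1) \<open>e > 0\<close> unfolding continuous_at_eps_delta by (meson half_gt_zero)
    obtain r2 where r2: "r2 > 0" "\<And>w. dist w z < r2 \<Longrightarrow> dist (?q w) (?q z) < e / 2"
      using cont(2) \<open>e > 0\<close> unfolding continuous_at_eps_delta by (meson half_gt_zero)
    \<comment> \<open>The factor 1/3 keeps the closed square of side \<open>h\<close> inside the
      ball of radius \<open>r\<close>: its points lie within \<open>2 * h < r\<close> of the
      corner.\<close>
    define r h where "r = min r0 (min r1 r2)" and "h = r / 3"
    have "r > 0" "h > 0"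
      using r0 r1 r2 by (auto simp: r_def h_def)
    define Z where "Z s t = Complex (s + Re z) (t + Im z)" for s t
    have near: "dist (Z s t) z < r" if "0 \<le> s" "s \<le> h" "0 \<le> t" "t \<le> h" for s t
    proof -
      have "dist (Z s t) z \<le> \<bar>s\<bar> + \<bar>t\<bar>"
        using cmod_le[of "Z s t - z"] by (simp add: Z_def dist_norm)
      also have "\<dots> \<le> 2 * h"
        using that by simp
      also have "\<dots> < r"
        using \<open>r > 0\<close> by (simp add: h_def)
      finally show ?thesis .
    qed
    have in_S: "Z s t \<in> S" if "0 \<le> s" "s \<le> h" "0 \<le> t" "t \<le> h" for s t
      using near[OF that] r0 by (auto simp: r_def dist_commute)
    have Dx: "((\<lambda>s. v (Z s t)) has_real_derivative partial_x v (Z s t)) (at s)"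
      and Dy: "((\<lambda>t. v (Z s t)) has_real_derivative partial_y v (Z s t)) (at t)"
      if "v differentiable (at (Z s t))" for v s t
      using DERIV_shift[of "\<lambda>s. v (Complex s (t + Im z))" _ s "Re z"]
        DERIV_shift[of "\<lambda>t. v (Complex (s + Re z) t)" _ t "Im z"]
        DERIV_partial_x[of v "s + Re z" "t + Im z"] DERIV_partial_y[of v "s + Re z" "t + Im z"] that
      by (simp_all add: Z_def)
    obtain s t where st: "0 < s" "s < h" "0 < t" "t < h"
      "u (Z h h) - u (Z h 0) - u (Z 0 h) + u (Z 0 0) = h\<^sup>2 * ?p (Z s t)"
      by (rule double_difference_mvt[OF \<open>h > 0\<close>, of "\<lambda>s t. u (Z s t)"
            "\<lambda>s t. partial_x u (Z s t)" "\<lambda>s t. ?p (Z s t)"])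
        (auto intro: Dx Dy diff in_S)
    \<comment> \<open>The same double difference with the coordinates exchanged; only its two middle
      terms change places.\<close>
    obtain t' s' where st': "0 < t'" "t' < h" "0 < s'" "s' < h"
      "u (Z h h) - u (Z 0 h) - u (Z h 0) + u (Z 0 0) = h\<^sup>2 * ?q (Z s' t')"
      by (rule double_difference_mvt[OF \<open>h > 0\<close>, of "\<lambda>t s. u (Z s t)"
            "\<lambda>t s. partial_y u (Z s t)" "\<lambda>t s. ?q (Z s t)"])
        (auto intro: Dx Dy diff in_S)
    have "h\<^sup>2 * ?p (Z s t) = h\<^sup>2 * ?q (Z s' t')"
      using st(5) st'(5) by linarith
    then have "?p (Z s t) = ?q (Z s' t')"
      using \<open>h > 0\<close> by simp
    moreover have "dist (?p (Z s t)) (?p z) < e / 2"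
      using near[of s t] st by (intro r1) (auto simp: r_def)
    moreover have "dist (?q (Z s' t')) (?q z) < e / 2"
      using near[of s' t'] st' by (intro r2) (auto simp: r_def)
    ultimately show ?thesis
      unfolding dist_real_def by arith
  qed
  \<comment> \<open>If the difference were nonzero, choosing it as \<open>e\<close> would make it
    smaller than itself.\<close>
  from this[of "\<bar>?p z - ?q z\<bar>"] show ?thesis
    by force
qed

text \<open>By the Cauchy--Riemann equations, \<open>u\<^sub>x - \<i> u\<^sub>y\<close> is holomorphic; take a primitive of it.\<close>

lemma harmonic_on_imp_Re_holomorphic:
  assumes S: "open S" "convex S" and u: "harmonic_on S u"
  obtains F where "F holomorphic_on S" "\<And>z. z \<in> S \<Longrightarrow> u z = Re (F z)"
proof (cases "S = {}")
  case True
  with that[of id] show thesis by simp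
next
  case False
  then obtain z0 where z0: "z0 \<in> S" by blast
  define g where "g z = complex_of_real (partial_x u z) - \<i> * complex_of_real (partial_y u z)" for z
  have diff: "u differentiable (at z)" "partial_x u differentiable (at z)"
    "partial_y u differentiable (at z)" if "z \<in> S" for z
    using u that unfolding harmonic_on_def C2_on_def C1_on_def by auto
  have lap: "partial_y (partial_y u) z = - partial_x (partial_x u) z" if "z \<in> S" for z
    using u that unfolding harmonic_on_def by (simp add: eq_neg_iff_add_eq_0 add.commute)
  have mixed: "partial_y (partial_x u) z = partial_x (partial_y u) z" if "z \<in> S" for z
    using mixed_partials_eq[OF S(1) that] u unfolding harmonic_on_def by blast
  have "(g has_field_derivative
      of_real (partial_x (partial_x u) z) - \<i> * of_real (partial_x (partial_y u) z)) (at z)"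
    if z: "z \<in> S" for z
  proof -
    have "(g has_derivative
      (\<lambda>w. of_real (Re w * partial_x (partial_x u) z + Im w * partial_y (partial_x u) z) -
        \<i> * of_real (Re w * partial_x (partial_y u) z + Im w * partial_y (partial_y u) z))) (at z)"
      unfolding g_def
      by (intro has_derivative_diff has_derivative_mult_right has_derivative_of_real
          has_derivative_partials diff z)
    moreover have "(\<lambda>w. of_real (Re w * partial_x (partial_x u) z + Im w * partial_y (partial_x u) z) -
        \<i> * of_real (Re w * partial_x (partial_y u) z + Im w * partial_y (partial_y u) z)) =
      (*) (of_real (partial_x (partial_x u) z) - \<i> * of_real (partial_x (partial_y u) z))"
      by (simp add: fun_eq_iff complex_eq_iff lap[OF z] mixed[OF z] algebra_simps)
    ultimately show ?thesis
      by (simp add: has_field_derivative_def)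
  qed
  then have "g holomorphic_on S"
    using S(1) by (auto simp: holomorphic_on_open)
  then obtain G where G: "\<And>z. z \<in> S \<Longrightarrow> (G has_field_derivative g z) (at z within S)"
    using holomorphic_convex_primitive'[OF S(2,1)] by blast
  then have GD: "(G has_field_derivative g z) (at z)" if "z \<in> S" for z
    using S(1) that by (metis at_within_open)
  \<comment> \<open>Since \<open>G' = g\<close>, the real part of \<open>g z * w\<close> is exactly
    the differential of \<open>u\<close> at \<open>z\<close>. Hence \<open>u\<close> and
    \<open>Re G\<close> differ by a constant on the convex set, which is then added to
    \<open>G\<close>.\<close>
  have "((\<lambda>w. u w - Re (G w)) has_derivative (\<lambda>h. 0)) (at z within S)" if "z \<in> S" for z
  proof -
    have "((\<lambda>w. u w - Re (G w)) has_derivative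
        (\<lambda>w. (Re w * partial_x u z + Im w * partial_y u z) - Re (g z * w))) (at z)"
      by (intro has_derivative_diff has_derivative_partials Re_has_derivative GD diff that)
    moreover have "(\<lambda>w. (Re w * partial_x u z + Im w * partial_y u z) - Re (g z * w)) = (\<lambda>h. 0)"
      by (simp add: fun_eq_iff g_def)
    ultimately show ?thesis
      by (simp add: has_derivative_at_withinI)
  qed
  then have "\<exists>k. \<forall>z\<in>S. u z - Re (G z) = k"
    by (rule has_derivative_zero_constant[OF S(2)])
  then obtain k where k: "\<And>z. z \<in> S \<Longrightarrow> u z - Re (G z) = k"
    by blast
  show thesis
  proof (rule that[of "\<lambda>z. G z + of_real k"])
    have "G holomorphic_on S"
      using GD S(1) by (auto simp: holomorphic_on_open)
    then show "(\<lambda>z. G z + of_real k) holomorphic_on S"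
      by (intro holomorphic_intros)
  qed (use k in force)
qed

text \<open>The last summand is the square of sinh (Im z). The formula is the one for the cosine,
  shifted by \<pi>/2.\<close>

lemma norm_sin_squared_Re_Im:
  "cmod (sin z) ^ 2 = sin (Re z) ^ 2 + (exp (Im z) - inverse (exp (Im z))) ^ 2 / 4"
  using norm_cos_squared[of "of_real pi / 2 - z"] sin_cos_eq[of "Re z"] sin_cos_eq[of z]
  by (simp add: exp_minus power2_commute)

section \<open>A Schwarz--Pick estimate for self-maps of the disk fixing 0\<close>

text \<open>The assumption places \<open>p\<close> in the closed pseudohyperbolic disk of radius
  \<open>t\<close> about \<open>q\<close>, and \<open>phi_real (cmod q) t\<close> bounds the moduli
  there. The proof combines \<open>|1 - cnj q * p|^2 = |p - q|^2 + (1 - P^2) (1 - c^2)\<close> with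
  \<open>1 - c P \<le> |1 - cnj q * p|\<close>.\<close>

lemma norm_le_Moebius:
  fixes p q :: complex
  assumes p: "cmod p < 1" and q: "cmod q < 1" and t: "0 \<le> t" "t < 1"
    and le: "cmod (p - q) \<le> t * cmod (1 - cnj q * p)"
  shows "cmod p \<le> phi_real (cmod q) t"
proof -
  define P c where "P = cmod p" and "c = cmod q"
  have "P * c < 1"
    using mult_strict_mono[of P 1 c 1] p q by (simp add: P_def c_def)
  have D: "cmod (1 - cnj q * p) ^ 2 = cmod (p - q) ^ 2 + (1 - P\<^sup>2) * (1 - c\<^sup>2)"
    unfolding P_def c_def cmod_power2 by (simp add: algebra_simps power2_eq_square)
  have "1 - c * P \<le> cmod (1 - cnj q * p)"
    using norm_triangle_ineq2[of 1 "cnj q * p"] by (simp add: norm_mult P_def c_def)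
  then have "(1 - c * P)\<^sup>2 \<le> cmod (1 - cnj q * p) ^ 2"
    using \<open>P * c < 1\<close> by (intro power_mono) (auto simp: mult.commute)
  then have "(1 - t\<^sup>2) * (1 - c * P)\<^sup>2 \<le> (1 - t\<^sup>2) * cmod (1 - cnj q * p) ^ 2"
    using t by (intro mult_left_mono) (auto simp: power_le_one)
  moreover have "cmod (p - q) ^ 2 \<le> t\<^sup>2 * cmod (1 - cnj q * p) ^ 2"
    using power_mono[OF le, of 2] by (simp add: power_mult_distrib)
  \<comment> \<open>This uses \<open>(1 - P^2) (1 - c^2) = (1 - c P)^2 - (P - c)^2\<close>.\<close>
  ultimately have "(P - c)\<^sup>2 \<le> (t * (1 - c * P))\<^sup>2"
    using D by (simp add: algebra_simps power2_eq_square)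
  then have "P - c \<le> t * (1 - c * P)"
    using t \<open>P * c < 1\<close> by (elim power2_le_imp_le) (simp add: mult.commute)
  then show ?thesis
    using t by (simp add: phi_real_def P_def c_def field_simps add_pos_nonneg)
qed

lemma Schwarz_Pick_at_zero:
  assumes hol: "f holomorphic_on unit_disk" and f0: "f 0 = 0"
    and lt: "\<And>z. cmod z < 1 \<Longrightarrow> cmod (f z) < 1" and z: "cmod z < 1"
  shows "cmod (f z) \<le> cmod z * phi_real (cmod (deriv f 0)) (cmod z)"
proof (cases "cmod (deriv f 0) = 1")
  case True
  then show ?thesis
    using Schwarz_Lemma(1)[OF hol f0 lt z] by (simp add: phi_real_one)
next
  case False
  obtain k where k: "k holomorphic_on unit_disk" "\<And>z. cmod z < 1 \<Longrightarrow> f z = z * k z"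
    and k0: "deriv f 0 = k 0"
    using Schwarz3[OF hol f0] by metis
  have k_lt: "cmod (k w) < 1" if w: "cmod w < 1" for w
  proof (cases "w = 0")
    case True
    then show ?thesis
      using False Schwarz_Lemma(2)[OF hol f0 lt w] k0 by simp
  next
    case w0: False
    \<comment> \<open>Equality in the Schwarz lemma would make \<open>f\<close> a rotation, whose
      derivative at 0 has modulus 1.\<close>
    have "cmod (f w) \<noteq> cmod w"
    proof
      assume "cmod (f w) = cmod w"
      then obtain \<alpha> where \<alpha>: "\<And>z. cmod z < 1 \<Longrightarrow> f z = \<alpha> * z" "cmod \<alpha> = 1"
        using Schwarz_Lemma(3)[OF hol f0 lt w] w w0 by blast
      have "deriv f 0 = \<alpha>"
      proof (rule DERIV_imp_deriv, rule has_field_derivative_transform_within_open)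
        show "((*) \<alpha> has_field_derivative \<alpha>) (at 0)"
          by (auto intro!: derivative_eq_intros)
      qed (use \<alpha> in \<open>auto intro: open_ball[of 0 1]\<close>)
      with \<alpha> False show False by simp
    qed
    then have "cmod w * cmod (k w) < cmod w * 1"
      using Schwarz_Lemma(1)[OF hol f0 lt w] k(2)[OF w] by (simp add: norm_mult)
    then show ?thesis
      using w0 by simp
  qed
  define m where "m = Moebius_function 0 (k 0) \<circ> k"
  have "m holomorphic_on unit_disk"
    unfolding m_def using k_lt
    by (intro holomorphic_on_compose_gen[OF k(1) Moebius_function_holomorphic]) auto
  moreover have "m 0 = 0"
    by (simp add: m_def Moebius_function_eq_zero)
  moreover have "cmod (m w) < 1" if "cmod w < 1" for w
    using Moebius_function_norm_lt_1 k_lt that by (simp add: m_def)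
  ultimately have m: "cmod (m z) \<le> cmod z"
    using Schwarz_Lemma(1) z by blast
  have "cmod (cnj (k 0) * k z) < 1"
    using mult_strict_mono[of "cmod (k 0)" 1 "cmod (k z)" 1] k_lt z by (simp add: norm_mult)
  then have "1 - cnj (k 0) * k z \<noteq> 0"
    by auto
  then have "cmod (k z - k 0) \<le> cmod z * cmod (1 - cnj (k 0) * k z)"
    using m by (simp add: m_def Moebius_function_simple norm_divide divide_simps)
  then have "cmod (k z) \<le> phi_real (cmod (k 0)) (cmod z)"
    using norm_le_Moebius k_lt z by simp
  then show ?thesis
    by (simp add: k0 k(2)[OF z] norm_mult mult_left_mono)
qed


section \<open>Trigonometry of the strip and the real Moebius map\<close>

text \<open>The difference of the squares factors as \<open>cos (2 * x) * cos (2 * y)\<close>, and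
  both factors are positive in this range.\<close>

lemma cos_add_gt_abs_sin_diff:
  fixes x y :: real
  assumes "\<bar>x\<bar> < pi / 4" "\<bar>y\<bar> < pi / 4"
  shows "\<bar>sin (x - y)\<bar> < cos (x + y)"
proof -
  have pos: "cos (x + y) > 0"
    using assms by (intro cos_gt_zero_pi) auto
  have "cos (2 * x) > 0" "cos (2 * y) > 0"
    using assms by (intro cos_gt_zero_pi; auto)+
  moreover have "cos (x + y) ^ 2 - sin (x - y) ^ 2 = cos (2 * x) * cos (2 * y)"
    unfolding cos_add sin_diff cos_double by algebra
  ultimately have "sin (x - y) ^ 2 < cos (x + y) ^ 2"
    by (metis diff_gt_0_iff_gt mult_pos_pos)
  then show ?thesis
    using pos by (metis abs_le_square_iff abs_of_pos not_le)
qed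

text \<open>The quotient is the image of \<open>tan x\<close> under the Moebius map with parameter
  \<open>- tan y\<close>, which the map with parameter \<open>tan y\<close> undoes. In the
  computation numerator and denominator both acquire the factor \<open>cos (2 * y)\<close>.\<close>

lemma phi_real_tan:
  fixes x y :: real
  assumes "\<bar>x\<bar> < pi / 4" "\<bar>y\<bar> < pi / 4"
  shows "phi_real (tan y) (sin (x - y) / cos (x + y)) = tan x"
proof -
  have pos: "cos (x + y) > 0" "cos x > 0" "cos y > 0"
    using assms by (intro cos_gt_zero_pi; auto)+
  have "cos (2 * y) > 0"
    using assms by (intro cos_gt_zero_pi) auto
  have c2: "cos (2 * y) = cos y * cos y - sin y * sin y"
    by (simp add: cos_double power2_eq_square)
  have n: "sin y * cos (x + y) + cos y * sin (x - y) = sin x * cos (2 * y)"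
    and d: "cos y * cos (x + y) + sin y * sin (x - y) = cos x * cos (2 * y)"
    unfolding c2 cos_add sin_diff by (simp_all add: algebra_simps)
  have "phi_real (tan y) (sin (x - y) / cos (x + y)) =
    (sin y * cos (x + y) + cos y * sin (x - y)) / (cos y * cos (x + y) + sin y * sin (x - y))"
    using pos by (simp add: phi_real_def tan_def divide_simps)
  also have "\<dots> = tan x"
    using \<open>cos (2 * y) > 0\<close> by (simp add: n d tan_def)
  finally show ?thesis .
qed

text \<open>The difference of the two values is
  \<open>(1 - a^2) (t - s) / ((1 + a s) (1 + a t))\<close>.\<close>

lemma phi_real_mono:
  assumes "\<bar>a\<bar> < 1" "\<bar>s\<bar> < 1" "\<bar>t\<bar> < 1" "s \<le> t"
  shows "phi_real a s \<le> phi_real a t"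
proof -
  have "1 + a * r > 0" if "\<bar>r\<bar> < 1" for r
    using abs_mult_less[OF assms(1) that] abs_mult[of a r] by linarith
  then have "1 + a * s > 0" "1 + a * t > 0"
    using assms by auto
  moreover have "0 \<le> (1 - a\<^sup>2) * (t - s)"
    using assms by (simp add: abs_square_less_1 less_imp_le)
  ultimately show ?thesis
    by (simp add: phi_real_def divide_simps algebra_simps power2_eq_square)
qed

lemma phi_real_bounds:
  assumes "0 \<le> c" "c \<le> 1" "0 \<le> t" "t < 1"
  shows "0 \<le> phi_real c t" "phi_real c t \<le> 1"
proof -
  have "c * t \<ge> 0" "(1 - c) * (1 - t) \<ge> 0"
    using assms by auto
  then show "0 \<le> phi_real c t" "phi_real c t \<le> 1"
    using assms by (auto simp: phi_real_def divide_simps algebra_simps)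
qed

section \<open>The bound for harmonic functions with values in the strip\<close>

text \<open>Dividing by \<open>cos (X + A)\<close>, which is positive, gives the estimate for the
  image of \<open>tan X\<close> under the Moebius map with parameter \<open>- tan A\<close>.\<close>

lemma harmonic_strip_bound:
  fixes u :: "complex \<Rightarrow> real" and b :: real
  assumes harm: "harmonic_on unit_disk u" and range: "u ` unit_disk \<subseteq> {-1<..<1}"
    and u0: "u 0 = b" and z: "cmod z < 1"
    and A: "A = b * pi / 4" and X: "X = u z * pi / 4"
    and c: "c = pi / 4 * (1 / cos (pi / 2 * b)) * norm (gradient u 0)"
  shows "\<bar>sin (X - A)\<bar> \<le> cmod z * phi_real c (cmod z) * cos (X + A)"
proof -
  obtain F0 where F0: "F0 holomorphic_on unit_disk" "\<And>w. w \<in> unit_disk \<Longrightarrow> u w = Re (F0 w)"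
    using harmonic_on_imp_Re_holomorphic[OF open_ball convex_ball harm] by blast
  \<comment> \<open>Removing the imaginary part at 0 makes \<open>F 0\<close> real, so that
    \<open>W 0 = A\<close> and hence \<open>h 0 = 0\<close>.\<close>
  define F where "F w = F0 w - \<i> * of_real (Im (F0 0))" for w
  have F: "F holomorphic_on unit_disk"
    unfolding F_def by (intro holomorphic_intros F0)
  have uF: "u w = Re (F w)" if "cmod w < 1" for w
    using F0(2) that by (simp add: F_def)
  have F_0: "F 0 = of_real b"
    using uF[of 0] u0 by (simp add: complex_eq_iff F_def)
  have strip: "\<bar>Re (F w)\<bar> < 1" if "cmod w < 1" for w
  proof -
    have "u w \<in> {-1<..<1}"
      using range that by (force simp: image_subset_iff)
    then show ?thesis
      by (simp add: uF[OF that] abs_less_iff)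
  qed
  define W where "W w = of_real (pi / 4) * F w" for w
  define h where "h w = sin (W w - of_real A) / cos (W w + of_real A)" for w
  have A_lt: "\<bar>A\<bar> < pi / 4"
    using strip[of 0] by (simp add: F_0 A abs_mult)
  have X_lt: "\<bar>Re (W w)\<bar> < pi / 4" if "cmod w < 1" for w
    using strip[OF that] by (simp add: W_def abs_mult)
  \<comment> \<open>This is the square of sinh (Im (W w)), the common summand of the squared moduli
    of sine and cosine.\<close>
  define e where "e w = (exp (Im (W w)) - inverse (exp (Im (W w)))) ^ 2 / 4" for w
  have e: "e w \<ge> 0" for w
    by (simp add: e_def)
  have sinW: "cmod (sin (W w - of_real A)) ^ 2 = sin (Re (W w) - A) ^ 2 + e w"
    and cosW: "cmod (cos (W w + of_real A)) ^ 2 = cos (Re (W w) + A) ^ 2 + e w" for w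
    by (simp_all add: norm_sin_squared_Re_Im norm_cos_squared e_def)
  have gt: "\<bar>sin (Re (W w) - A)\<bar> < cos (Re (W w) + A)" if "cmod w < 1" for w
    using cos_add_gt_abs_sin_diff X_lt[OF that] A_lt by blast
  have cos_nz: "cos (W w + of_real A) \<noteq> 0" if "cmod w < 1" for w
  proof
    assume "cos (W w + of_real A) = 0"
    then have "cos (Re (W w) + A) ^ 2 = 0"
      using cosW[of w] e[of w] by (simp add: add_nonneg_eq_0_iff)
    then show False
      using gt[OF that] by simp
  qed
  have h_lt: "cmod (h w) < 1" if "cmod w < 1" for w
  proof -
    have "sin (Re (W w) - A) ^ 2 < cos (Re (W w) + A) ^ 2"
      using gt[OF that] power_strict_mono[of "\<bar>sin (Re (W w) - A)\<bar>" _ 2] by simp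
    then have "cmod (sin (W w - of_real A)) ^ 2 < cmod (cos (W w + of_real A)) ^ 2"
      unfolding sinW cosW by simp
    then have "cmod (sin (W w - of_real A)) < cmod (cos (W w + of_real A))"
      by (rule power_less_imp_less_base) simp
    then show ?thesis
      using cos_nz[OF that] by (simp add: h_def norm_divide)
  qed
  have h_hol: "h holomorphic_on unit_disk"
    unfolding h_def W_def using cos_nz by (intro holomorphic_intros F) (auto simp: W_def)
  have W0: "W 0 = of_real A"
    by (simp add: W_def F_0 A)
  then have h0: "h 0 = 0"
    by (simp add: h_def)
  have FD: "(F has_field_derivative deriv F 0) (at 0)"
    using F by (intro holomorphic_derivI[of _ unit_disk]) auto
  have "norm (gradient (\<lambda>w. Re (F w)) 0) = norm (gradient u 0)"
    using C1_on_cong(2,3)[OF open_ball C1_on_Re[OF open_ball F], of u 0] uF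
    by (simp add: norm_gradient)
  then have grad: "norm (gradient u 0) = cmod (deriv F 0)"
    using norm_gradient_Re[OF FD] by simp
  have cos2A: "cos (A + A) > 0"
    using A_lt by (intro cos_gt_zero_pi) auto
  have A2: "A + A = pi / 2 * b"
    by (simp add: A)
  \<comment> \<open>The numerator of \<open>h\<close> vanishes at 0, so only its derivative
    \<open>W' 0\<close> over the denominator \<open>cos (2 * A)\<close> survives in the quotient
    rule.\<close>
  have "(h has_field_derivative of_real (pi / 4) * deriv F 0 / cos (of_real (A + A))) (at 0)"
    using cos2A cos_nz[of 0] W0 unfolding h_def W_def
    by (auto intro!: derivative_eq_intros FD simp: field_simps)
  then have "deriv h 0 = of_real (pi / 4) * deriv F 0 / cos (of_real (A + A))"
    by (rule DERIV_imp_deriv)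
  moreover have "cmod (cos (of_real (A + A))) = cos (pi / 2 * b)"
    using cos2A by (simp only: cos_of_real norm_of_real abs_of_pos A2)
  ultimately have "cmod (deriv h 0) = c"
    by (simp only: norm_mult norm_divide norm_of_real c grad) simp
  then have "cmod (h z) \<le> cmod z * phi_real c (cmod z)"
    using Schwarz_Pick_at_zero[OF h_hol h0 h_lt z] by simp
  moreover have "\<bar>sin (X - A)\<bar> \<le> cmod (h z) * cos (X + A)"
  proof -
    have XW: "X = Re (W z)"
      using uF[OF z] by (simp add: X W_def)
    let ?s = "sin (X - A)" and ?c = "cos (X + A)"
    have "?s\<^sup>2 \<le> ?c\<^sup>2" "?c > 0"
      using gt[OF z] power_mono[of "\<bar>?s\<bar>" ?c 2] unfolding XW by auto
    \<comment> \<open>Adding \<open>e z\<close> to the numerator and denominator of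
      \<open>?s^2 / ?c^2\<close>, which is at most 1, cannot decrease it; the argument runs with
      denominators cleared.\<close>
    then have "?s\<^sup>2 * e z \<le> ?c\<^sup>2 * e z"
      using e by (intro mult_right_mono)
    then have "?s\<^sup>2 * cmod (cos (W z + of_real A)) ^ 2 \<le> cmod (sin (W z - of_real A)) ^ 2 * ?c\<^sup>2"
      unfolding sinW cosW XW[symmetric] by (simp add: algebra_simps)
    then have "?s\<^sup>2 \<le> (cmod (h z) * ?c)\<^sup>2"
      using cos_nz[OF z] by (simp add: h_def norm_divide power_mult_distrib power_divide field_simps)
    then have "\<bar>?s\<bar> \<le> \<bar>cmod (h z) * ?c\<bar>"
      using abs_le_square_iff by blast
    then show ?thesis
      using \<open>?c > 0\<close> by (simp add: abs_mult)
  qed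
  moreover have "cos (X + A) \<ge> 0"
    using gt[OF z] uF[OF z] by (simp add: X W_def mult.commute)
  ultimately show ?thesis
    by (meson mult_right_mono order_trans)
qed

section \<open>Extremal functions\<close>

lemma phi_eq_Moebius: "phi \<alpha> z = Moebius_function 0 (- \<alpha>) z"
  by (simp add: phi_def Moebius_function_simple add.commute)

text \<open>The value \<open>c = 1\<close> arises when \<open>d\<close> is as large as allowed. The
  Moebius map then degenerates to the constant 1 on the disk.\<close>

lemma holomorphic_on_phi_of_real:
  assumes "\<bar>c\<bar> < 1 \<or> c = 1"
  shows "phi (of_real c) holomorphic_on unit_disk"
proof (cases "c = 1")
  case True
  have "phi 1 z = 1" if "z \<in> unit_disk" for z
    using that by (auto simp: phi_def add_eq_0_iff)
  then show ?thesis
    using True holomorphic_transform[OF holomorphic_on_const[of 1]] by (metis of_real_1)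
next
  case False
  then show ?thesis
    using assms Moebius_function_holomorphic[of "- of_real c" 0] by (simp add: phi_eq_Moebius[abs_def])
qed

lemma norm_phi_of_real_le_one:
  assumes "\<bar>c\<bar> < 1 \<or> c = 1" "cmod z < 1"
  shows "cmod (phi (of_real c) z) \<le> 1"
proof (cases "c = 1")
  case True
  have "1 + z \<noteq> 0"
    using assms(2) by (auto simp: add_eq_0_iff)
  with True show ?thesis
    by (simp add: phi_def)
next
  case False
  then show ?thesis
    using assms Moebius_function_norm_lt_1[of "- of_real c" z 0] by (simp add: phi_eq_Moebius)
qed

text \<open>For \<open>w = Arctan z\<close>, the inequality \<open>|tan w| < 1\<close> means
  \<open>|sin w| < |cos w|\<close>. The hyperbolic terms of the squared moduli cancel, leaving
  \<open>cos (2 * Re w) > 0\<close>.\<close>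

lemma abs_Re_Arctan_less:
  assumes "cmod z < 1"
  shows "\<bar>Re (Arctan z)\<bar> < pi / 4"
proof -
  let ?w = "Arctan z"
  have "\<bar>Im z\<bar> < 1"
    using assms abs_Im_le_cmod[of z] by linarith
  then have lt: "\<bar>Re ?w\<bar> < pi / 2"
    by (intro Re_Arctan_bounds) auto
  have "z\<^sup>2 \<noteq> -1"
  proof
    assume "z\<^sup>2 = -1"
    then have "cmod z ^ 2 = 1"
      by (metis norm_minus_cancel norm_one norm_power)
    then show False
      using assms by (simp add: abs_square_eq_1)
  qed
  then have t: "tan ?w = z"
    by simp
  \<comment> \<open>Where the cosine vanishes, \<open>tan\<close> would be 0 by division by zero and
    \<open>|tan w| < 1\<close> would say nothing about the sine.\<close>
  have "cos ?w \<noteq> 0"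
  proof
    assume "cos ?w = 0"
    then have "cos (Re ?w) ^ 2 = 0"
      using norm_cos_squared[of ?w] by (simp add: add_nonneg_eq_0_iff)
    moreover have "cos (Re ?w) > 0"
      using lt by (intro cos_gt_zero_pi) auto
    ultimately show False
      by simp
  qed
  moreover have "cmod (tan ?w) < 1"
    using assms t by simp
  ultimately have "cmod (sin ?w) < cmod (cos ?w)"
    by (simp only: tan_def norm_divide) (simp add: divide_less_eq)
  then have "cmod (sin ?w) ^ 2 < cmod (cos ?w) ^ 2"
    by (intro power_strict_mono) auto
  then have "cos (2 * Re ?w) > 0"
    by (simp add: norm_sin_squared_Re_Im norm_cos_squared cos_double)
  \<comment> \<open>The absolute value brings the argument into \<open>[0, pi]\<close>, where the
    cosine is strictly decreasing.\<close>
  then have "cos \<bar>2 * Re ?w\<bar> > cos (pi / 2)"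
    by simp
  then have "\<bar>2 * Re ?w\<bar> < pi / 2"
    using lt by (subst (asm) cos_mono_less_eq) auto
  then show ?thesis
    by simp
qed

lemma strip_parameter_bounds:
  fixes b :: real
  assumes "b \<in> {-1<..<1}"
  shows "\<bar>b * pi / 4\<bar> < pi / 4" "\<bar>tan (b * pi / 4)\<bar> < 1" "cos (pi / 2 * b) > 0"
proof -
  have "\<bar>b\<bar> < 1"
    using assms by auto
  then have lt: "\<bar>b * pi\<bar> < pi"
    by (simp add: abs_mult)
  then show A: "\<bar>b * pi / 4\<bar> < pi / 4"
    by linarith
  have "tan (b * pi / 4) < tan (pi / 4)" "tan (- (pi / 4)) < tan (b * pi / 4)"
    using A by (intro tan_monotone; linarith)+
  then show "\<bar>tan (b * pi / 4)\<bar> < 1"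
    by (simp add: tan_45)
  have "cos (b * pi / 2) > 0"
    using lt by (intro cos_gt_zero_pi) linarith+
  then show "cos (pi / 2 * b) > 0"
    by (simp add: mult.commute)
qed

text \<open>One construction serves both bounds: \<open>s = 1\<close> for the upper and
  \<open>s = -1\<close> for the lower. The rotation \<open>e\<close> moves \<open>z\<close> to the
  nonnegative real axis, where every map involved takes real values.\<close>

lemma extremal_function_exists:
  fixes a b c s :: real and e :: complex
  assumes b: "b \<in> {-1<..<1}" and a: "a = tan (b * pi / 4)" and c: "0 \<le> c" "c \<le> 1"
    and s: "\<bar>s\<bar> = 1" and e: "cmod e = 1" and z: "cmod z < 1" and ez: "e * z = of_real (cmod z)"
  shows "\<exists>u. harmonic_on unit_disk u \<and> u ` unit_disk \<subseteq> {-1<..<1} \<and> u 0 = b \<and>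
    norm (gradient u 0) = 4 / pi * cos (pi / 2 * b) * c \<and>
    u z = 4 / pi * arctan (phi_real a (s * (cmod z * phi_real c (cmod z))))"
proof -
  define h where "h w = of_real s * (e * w * phi (of_real c) (e * w))" for w
  define g where "g w = phi (of_real a) (h w)" for w
  define F where "F w = of_real (4 / pi) * Arctan (g w)" for w
  note A_lt = strip_parameter_bounds(1)[OF b] and a_lt = strip_parameter_bounds(2)[OF b, folded a]
    and cos_pos = strip_parameter_bounds(3)[OF b]
  have arctan_a: "arctan a = b * pi / 4"
    unfolding a using A_lt by (intro arctan_tan) linarith+
  have c': "\<bar>c\<bar> < 1 \<or> c = 1"
    using c by auto
  have ball: "e * w \<in> unit_disk" if "w \<in> unit_disk" for w
    using that e by (simp add: norm_mult)
  have h_lt: "cmod (h w) < 1" if w: "w \<in> unit_disk" for w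
  proof -
    have "cmod (h w) = cmod w * cmod (phi (of_real c) (e * w))"
      using s e by (simp add: h_def norm_mult)
    also have "\<dots> \<le> cmod w * 1"
      using norm_phi_of_real_le_one[OF c'] ball[OF w] by (intro mult_left_mono) auto
    finally show ?thesis
      using w by simp
  qed
  have g_lt: "cmod (g w) < 1" if w: "w \<in> unit_disk" for w
    using Moebius_function_norm_lt_1[of "- of_real a" "h w" 0] a_lt h_lt[OF w]
    by (simp add: g_def phi_eq_Moebius)
  have "(\<lambda>w. phi (of_real c) (e * w)) holomorphic_on unit_disk"
    using holomorphic_on_compose_gen[OF _ holomorphic_on_phi_of_real[OF c'], of "\<lambda>w. e * w" unit_disk] ball
    by (auto simp: o_def image_subset_iff intro!: holomorphic_intros)
  then have h_hol: "h holomorphic_on unit_disk"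
    unfolding h_def by (intro holomorphic_intros)
  have g_hol: "g holomorphic_on unit_disk"
    using holomorphic_on_compose_gen[OF h_hol holomorphic_on_phi_of_real[of a]] a_lt h_lt
    by (auto simp: o_def g_def[abs_def] image_subset_iff)
  have Arctan_dom: "\<bar>Im (g w)\<bar> < 1" if "w \<in> unit_disk" for w
    using g_lt[OF that] abs_Im_le_cmod[of "g w"] by linarith
  have "Arctan \<circ> g holomorphic_on unit_disk"
    using Arctan_dom
    by (intro holomorphic_on_compose g_hol holomorphic_on_Arctan) auto
  then have F_hol: "F holomorphic_on unit_disk"
    unfolding F_def o_def by (intro holomorphic_intros)
  have "\<bar>Re (F w)\<bar> < 1" if "w \<in> unit_disk" for w
    using abs_Re_Arctan_less[OF g_lt[OF that]] by (simp add: F_def abs_mult field_simps)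
  then have F_range: "(\<lambda>w. Re (F w)) ` unit_disk \<subseteq> {-1<..<1}"
    by (force simp: abs_less_iff)
  have h0: "h 0 = 0"
    by (simp add: h_def)
  have g0: "g 0 = of_real a"
    by (simp add: g_def h0 phi_def)
  have F0: "Re (F 0) = b"
    by (simp add: F_def g0 Arctan_of_real arctan_a)
  \<comment> \<open>Because of the factor \<open>e * w\<close>, only the value \<open>c\<close> of
    \<open>phi (of_real c)\<close> at 0 enters the derivative of \<open>h\<close> there.\<close>
  have "(h has_field_derivative of_real s * (e * of_real c)) (at 0)"
    unfolding h_def phi_def by (auto intro!: derivative_eq_intros)
  then have "(g has_field_derivative (1 - of_real a ^ 2) * (of_real s * (e * of_real c))) (at 0)"
    unfolding g_def phi_def
    by (auto intro!: derivative_eq_intros simp: h0 power2_eq_square algebra_simps)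
  then have "(F has_field_derivative of_real (4 / pi) *
      (inverse (1 + g 0 ^ 2) * ((1 - of_real a ^ 2) * (of_real s * (e * of_real c))))) (at 0)"
    unfolding F_def using Arctan_dom[of 0]
    by (intro DERIV_cmult DERIV_chain2[OF has_field_derivative_Arctan]) auto
  then have "norm (gradient (\<lambda>w. Re (F w)) 0) = cmod (of_real (4 / pi) *
      (inverse (1 + g 0 ^ 2) * ((1 - of_real a ^ 2) * (of_real s * (e * of_real c)))))"
    by (rule norm_gradient_Re)
  also have "\<dots> = cmod (of_real (4 / pi) *
      (of_real (inverse (1 + a\<^sup>2) * (1 - a\<^sup>2)) * (of_real s * (e * of_real c))))"
    by (simp add: g0 mult.assoc)
  also have "\<dots> = 4 / pi * (cmod (of_real (inverse (1 + a\<^sup>2) * (1 - a\<^sup>2))) * c)"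
    using s e c by (simp only: norm_mult norm_of_real) simp
  \<comment> \<open>The factors contributed by the arctangent and the outer Moebius map combine to
    the double-angle formula for \<open>cos (2 * A)\<close> with \<open>a = tan A\<close>,
    \<open>A = b * pi / 4\<close>.\<close>
  also have "inverse (1 + a\<^sup>2) * (1 - a\<^sup>2) = cos (pi / 2 * b)"
  proof -
    have "cos (b * pi / 4) > 0"
      using A_lt by (intro cos_gt_zero_pi) linarith+
    then have "inverse (1 + a\<^sup>2) * (1 - a\<^sup>2) = cos (b * pi / 4) ^ 2 - sin (b * pi / 4) ^ 2"
      using sin_cos_squared_add[of "b * pi / 4"]
      by (simp add: a tan_def power_divide field_simps)
    also have "\<dots> = cos (2 * (b * pi / 4))"
      by (simp only: cos_double)
    finally show ?thesis
      by (simp add: mult.commute)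
  qed
  also have "cmod (of_real (cos (pi / 2 * b))) = cos (pi / 2 * b)"
    using cos_pos by simp
  finally have "norm (gradient (\<lambda>w. Re (F w)) 0) = 4 / pi * cos (pi / 2 * b) * c"
    by simp
  moreover have "Re (F z) = 4 / pi * arctan (phi_real a (s * (cmod z * phi_real c (cmod z))))"
  proof -
    have "h z = of_real (s * (cmod z * phi_real c (cmod z)))"
      by (simp add: h_def ez phi_of_real)
    then show ?thesis
      by (simp only: F_def g_def phi_of_real Arctan_of_real) simp
  qed
  ultimately show ?thesis
    using harmonic_on_Re[OF open_ball F_hol] F_range F0 by blast
qed

theorem theorem11:
  fixes a b c d :: real
  assumes b: "b \<in> {-1<..<1}"
    and d_nonneg: "d \<ge> 0"
    and d_le: "d \<le> 4 / pi * cos (pi / 2 * b)"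
    and a: "a = tan (b * pi / 4)"
    and c: "c = pi / 4 * (1 / cos (pi / 2 * b)) * d"
  shows "(\<forall>u :: complex \<Rightarrow> real.
            harmonic_on unit_disk u \<and> u ` unit_disk \<subseteq> {-1<..<1} \<and>
            u 0 = b \<and> norm (gradient u 0) = d \<longrightarrow>
            (\<forall>z\<in>unit_disk.
               4 / pi * arctan (phi_real a (- (cmod z * phi_real c (cmod z)))) \<le> u z \<and>
               u z \<le> 4 / pi * arctan (phi_real a (cmod z * phi_real c (cmod z))))) \<and>
         (\<forall>z\<in>unit_disk. \<exists>u_hat u_tilde :: complex \<Rightarrow> real.
            harmonic_on unit_disk u_hat \<and> u_hat ` unit_disk \<subseteq> {-1<..<1} \<and>
            u_hat 0 = b \<and> norm (gradient u_hat 0) = d \<and>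
            harmonic_on unit_disk u_tilde \<and> u_tilde ` unit_disk \<subseteq> {-1<..<1} \<and>
            u_tilde 0 = b \<and> norm (gradient u_tilde 0) = d \<and>
            u_hat z = 4 / pi * arctan (phi_real a (- (cmod z * phi_real c (cmod z)))) \<and>
            u_tilde z = 4 / pi * arctan (phi_real a (cmod z * phi_real c (cmod z))))"
proof (intro conjI allI impI ballI; (elim conjE)?)
  note A_lt = strip_parameter_bounds(1)[OF b] and a_lt = strip_parameter_bounds(2)[OF b, folded a]
    and cos_pos = strip_parameter_bounds(3)[OF b]
  \<comment> \<open>The upper bound assumed for \<open>d\<close> is exactly
    \<open>c \<le> 1\<close>.\<close>
  have c01: "0 \<le> c" "c \<le> 1"
    using cos_pos d_nonneg d_le by (simp_all add: c field_simps)
  {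
    fix u :: "complex \<Rightarrow> real" and z :: complex
    assume u: "harmonic_on unit_disk u" "u ` unit_disk \<subseteq> {-1<..<1}" "u 0 = b"
      "norm (gradient u 0) = d" and "z \<in> unit_disk"
    then have z: "cmod z < 1"
      by simp
    define A X where "A = b * pi / 4" and "X = u z * pi / 4"
    \<comment> \<open>\<open>t\<close> is chosen so that \<open>phi_real a t = tan X\<close>: a
      bound on \<open>|t|\<close> thus becomes a two-sided bound on \<open>u z\<close>.\<close>
    define r t where "r = cmod z * phi_real c (cmod z)" and "t = sin (X - A) / cos (X + A)"
    have "u z \<in> {-1<..<1}"
      using u(2) \<open>z \<in> unit_disk\<close> by blast
    then have X_lt: "\<bar>X\<bar> < pi / 4"
      by (simp add: X_def abs_mult abs_less_iff)
    have "cos (X + A) > 0"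
      using cos_add_gt_abs_sin_diff[OF X_lt A_lt] unfolding A_def by linarith
    then have "\<bar>t\<bar> \<le> r"
      using harmonic_strip_bound[OF u(1,2,3) z A_def X_def] c u(4)
      by (simp add: r_def t_def abs_divide divide_le_eq)
    \<comment> \<open>With \<open>r < 1\<close>, the points \<open>- r\<close>, \<open>t\<close> and
      \<open>r\<close> all lie in (-1,1), where \<open>phi_real a\<close> is increasing.\<close>
    have "r \<le> cmod z * 1"
      unfolding r_def using phi_real_bounds[OF c01 _ z] by (intro mult_left_mono) auto
    then have "r < 1"
      using z by simp
    have "u z = 4 / pi * arctan (phi_real a t)"
    proof -
      have "phi_real a t = tan X"
        using phi_real_tan[OF X_lt] A_lt by (simp add: a t_def A_def)
      moreover have "arctan (tan X) = X"
        using X_lt by (intro arctan_tan) auto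
      ultimately show ?thesis
        by (simp add: X_def[symmetric]) (simp add: X_def)
    qed
    moreover have "phi_real a (- r) \<le> phi_real a t" "phi_real a t \<le> phi_real a r"
      using \<open>\<bar>t\<bar> \<le> r\<close> \<open>r < 1\<close> by (auto intro!: phi_real_mono a_lt)
    ultimately show "4 / pi * arctan (phi_real a (- (cmod z * phi_real c (cmod z)))) \<le> u z"
      "u z \<le> 4 / pi * arctan (phi_real a (cmod z * phi_real c (cmod z)))"
      by (simp_all add: r_def divide_right_mono arctan_le_iff)
  }
  fix z :: complex
  assume "z \<in> unit_disk"
  then have z: "cmod z < 1"
    by simp
  obtain e where e: "cmod e = 1" "e * z = of_real (cmod z)"
  proof (cases "z = 0")
    case True
    with that[of 1] show thesis by simp
  next
    case False
    then show thesis
      by (intro that[of "of_real (cmod z) / z"]) (simp_all add: norm_divide)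
  qed
  \<comment> \<open>The definition of \<open>c\<close> solved for \<open>d\<close>, so the gradient
    norm of the extremal functions is the prescribed one.\<close>
  have d: "4 / pi * cos (pi / 2 * b) * c = d"
    using cos_pos by (simp add: c)
  from extremal_function_exists[OF b a c01 _ e(1) z e(2), of "-1"]
    extremal_function_exists[OF b a c01 _ e(1) z e(2), of 1]
  show "\<exists>u_hat u_tilde :: complex \<Rightarrow> real.
      harmonic_on unit_disk u_hat \<and> u_hat ` unit_disk \<subseteq> {-1<..<1} \<and>
      u_hat 0 = b \<and> norm (gradient u_hat 0) = d \<and>
      harmonic_on unit_disk u_tilde \<and> u_tilde ` unit_disk \<subseteq> {-1<..<1} \<and>
      u_tilde 0 = b \<and> norm (gradient u_tilde 0) = d \<and>
      u_hat z = 4 / pi * arctan (phi_real a (- (cmod z * phi_real c (cmod z)))) \<and>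
      u_tilde z = 4 / pi * arctan (phi_real a (cmod z * phi_real c (cmod z)))"
    unfolding d by (simp only: abs_minus_cancel abs_one mult_minus1 mult_1 simp_thms) blast
qed

end
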